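(* Let $X\subseteq\mathbb{R}^d$ be a centrally symmetric convex body and let $\mathcal{E}$ be an ellipsoid. Assume that every ellipsoid $\mathcal{E}^*$ that (i) contains $X$ and (ii) has aspect ratio at most $\kappa(X)$ also contains $\mathcal{E}$. Then $\mathcal{E}\subseteq\sqrt{2}\cdot X$.
   Context: All ellipsoids are centered at the origin. The aspect ratio of an ellipsoid is the ratio of its longest to its shortest semi-axis. For a centrally symmetric convex body $X$, $\kappa(X)=R/r$ where $r$ is the radius of the largest Euclidean ball $r\cdot B_2^d$ contained in $X$ and $R$ is the radius of the smallest Euclidean ball $R\cdot B_2^d$ containing $X$. *)

theory Defs
  imports "HOL-Analysis.Analysis"
begin

definition symmetric_convex_body :: "(real^'n) set \<Rightarrow> bool" where
  "symmetric_convex_body X \<longleftrightarrow>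
     convex X \<and> compact X \<and> interior X \<noteq> {} \<and> (\<forall>x\<in>X. - x \<in> X)"

definition inner_radius :: "(real^'n) set \<Rightarrow> real" where
  "inner_radius X = Sup {r. 0 \<le> r \<and> cball 0 r \<subseteq> X}"

definition outer_radius :: "(real^'n) set \<Rightarrow> real" where
  "outer_radius X = Inf {R. 0 \<le> R \<and> X \<subseteq> cball 0 R}"

definition kappa :: "(real^'n) set \<Rightarrow> real" where
  "kappa X = outer_radius X / inner_radius X"

(* Origin-centred, non-degenerate: the images under f of the coordinate directions are the
   directions of the axes, and a gives the lengths of the semi-axes. *)
definition has_semi_axes :: "(real^'n) set \<Rightarrow> ('n \<Rightarrow> real) \<Rightarrow> bool" where
  "has_semi_axes E a \<longleftrightarrow> (\<forall>i. 0 < a i) \<and>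
     (\<exists>f. orthogonal_transformation f \<and>
          E = f ` {x. (\<Sum>i\<in>UNIV. (x $ i / a i)\<^sup>2) \<le> 1})"

definition ellipsoid :: "(real^'n) set \<Rightarrow> bool" where
  "ellipsoid E \<longleftrightarrow> (\<exists>a. has_semi_axes E a)"

(* The semi-axes are determined by E only up to order; has_semi_axes_aspect_ratio below shows
   that the ratio is well-defined. *)
definition aspect_ratio :: "(real^'n) set \<Rightarrow> real" where
  "aspect_ratio E = (THE q. \<exists>a. has_semi_axes E a \<and> q = Max (range a) / Min (range a))"

lemma norm_axis: "norm (axis k r :: real^'n) = \<bar>r\<bar>"
  by (simp add: norm_eq_sqrt_inner inner_axis_axis)

lemma has_semi_axes_subset_cball_iff:
  fixes E :: "(real^'n) set"
  assumes "has_semi_axes E a" "0 \<le> r"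
  shows "E \<subseteq> cball 0 r \<longleftrightarrow> Max (range a) \<le> r"
proof -
  obtain f where f: "orthogonal_transformation f"
    and E: "E = f ` {x. (\<Sum>i\<in>UNIV. (x $ i / a i)\<^sup>2) \<le> 1}" and pos: "\<And>i. 0 < a i"
    using assms(1) unfolding has_semi_axes_def by blast
  have nf: "norm (f x) = norm x" for x
    using f by (simp add: orthogonal_transformation_norm)
  have nsq: "(norm x)\<^sup>2 = (\<Sum>i\<in>UNIV. (x $ i)\<^sup>2)" for x :: "real^'n"
    by (simp add: norm_vec_def L2_set_def sum_nonneg)
  show ?thesis
  proof
    assume sub: "E \<subseteq> cball 0 r"
    have "a k \<le> r" for k
    proof -
      have "(\<Sum>i\<in>UNIV. (axis k (a k) $ i / a i)\<^sup>2) = (\<Sum>i\<in>UNIV. if i = k then 1 else 0)"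
        using pos[of k] by (intro sum.cong) (auto simp: axis_def)
      then have "f (axis k (a k)) \<in> E"
        unfolding E by (intro imageI) simp
      then show ?thesis
        using sub nf[of "axis k (a k)"] pos[of k] by (auto simp: norm_axis)
    qed
    then show "Max (range a) \<le> r" by simp
  next
    assume M: "Max (range a) \<le> r"
    have "norm x \<le> r" if "(\<Sum>i\<in>UNIV. (x $ i / a i)\<^sup>2) \<le> 1" for x
    proof -
      have "(norm x)\<^sup>2 \<le> (\<Sum>i\<in>UNIV. r\<^sup>2 * (x $ i / a i)\<^sup>2)"
        unfolding nsq
      proof (rule sum_mono)
        fix i
        have "a i \<le> r" using M by simp
        then have "(a i)\<^sup>2 \<le> r\<^sup>2" using pos[of i] by (intro power_mono) auto
        then have "(a i)\<^sup>2 * (x $ i / a i)\<^sup>2 \<le> r\<^sup>2 * (x $ i / a i)\<^sup>2"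
          by (intro mult_right_mono) auto
        then show "(x $ i)\<^sup>2 \<le> r\<^sup>2 * (x $ i / a i)\<^sup>2"
          using pos[of i] by (simp add: power_divide)
      qed
      also have "\<dots> \<le> r\<^sup>2 * 1"
        unfolding sum_distrib_left[symmetric] using that by (intro mult_left_mono) auto
      finally have "(norm x)\<^sup>2 \<le> r\<^sup>2" by simp
      then show ?thesis using assms(2) by (rule power2_le_imp_le)
    qed
    then show "E \<subseteq> cball 0 r" unfolding E by (auto simp: nf)
  qed
qed

lemma cball_subset_has_semi_axes_iff:
  fixes E :: "(real^'n) set"
  assumes "has_semi_axes E a" "0 \<le> r"
  shows "cball 0 r \<subseteq> E \<longleftrightarrow> r \<le> Min (range a)"
proof -
  obtain f where f: "orthogonal_transformation f"
    and E: "E = f ` {x. (\<Sum>i\<in>UNIV. (x $ i / a i)\<^sup>2) \<le> 1}" and pos: "\<And>i. 0 < a i"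
    using assms(1) unfolding has_semi_axes_def by blast
  have nf: "norm (f x) = norm x" for x
    using f by (simp add: orthogonal_transformation_norm)
  have inj: "inj f" and surj: "surj f"
    using f by (simp_all add: orthogonal_transformation_inj orthogonal_transformation_surj)
  have mem: "f x \<in> E \<longleftrightarrow> (\<Sum>i\<in>UNIV. (x $ i / a i)\<^sup>2) \<le> 1" for x
    unfolding E using inj by (simp add: inj_image_mem_iff)
  have nsq: "(norm x)\<^sup>2 = (\<Sum>i\<in>UNIV. (x $ i)\<^sup>2)" for x :: "real^'n"
    by (simp add: norm_vec_def L2_set_def sum_nonneg)
  show ?thesis
  proof
    assume sub: "cball 0 r \<subseteq> E"
    have "r \<le> a k" for k
    proof -
      have "f (axis k r) \<in> cball 0 r" using nf[of "axis k r"] assms(2) by (simp add: norm_axis)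
      then have "(\<Sum>i\<in>UNIV. (axis k r $ i / a i)\<^sup>2) \<le> 1" using sub mem by blast
      moreover have "(\<Sum>i\<in>UNIV. (axis k r $ i / a i)\<^sup>2) =
          (\<Sum>i\<in>UNIV. if i = k then (r / a k)\<^sup>2 else 0)"
        by (intro sum.cong) (auto simp: axis_def)
      ultimately have "(r / a k)\<^sup>2 \<le> 1\<^sup>2" by simp
      then have "r / a k \<le> 1" by (rule power2_le_imp_le) simp
      then show ?thesis using pos[of k] by (simp add: field_simps)
    qed
    then show "r \<le> Min (range a)" by simp
  next
    assume M: "r \<le> Min (range a)"
    show "cball 0 r \<subseteq> E"
    proof
      fix y :: "real^'n" assume y: "y \<in> cball 0 r"
      obtain x where x: "y = f x" using surj by (meson surjD)
      have nx: "norm x \<le> r" using y nf x by simp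
      show "y \<in> E"
      proof (cases "r = 0")
        case True
        then show ?thesis using nx x mem by simp
      next
        case False
        then have r: "0 < r" using assms(2) by simp
        have "(\<Sum>i\<in>UNIV. (x $ i / a i)\<^sup>2) \<le> (\<Sum>i\<in>UNIV. (x $ i)\<^sup>2 / r\<^sup>2)"
        proof (rule sum_mono)
          fix i
          have "r \<le> a i" using M by simp
          then have "r\<^sup>2 \<le> (a i)\<^sup>2" using r by (intro power_mono) auto
          then show "(x $ i / a i)\<^sup>2 \<le> (x $ i)\<^sup>2 / r\<^sup>2"
            unfolding power_divide using r pos[of i] by (intro divide_left_mono) auto
        qed
        also have "\<dots> = (norm x / r)\<^sup>2"
          by (simp add: sum_divide_distrib[symmetric] nsq power_divide)
        also have "\<dots> \<le> 1\<^sup>2" using nx r by (intro power_mono) auto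
        finally show ?thesis using mem x by simp
      qed
    qed
  qed
qed

lemma has_semi_axes_aspect_ratio:
  fixes E :: "(real^'n) set"
  assumes "has_semi_axes E a"
  shows "aspect_ratio E = Max (range a) / Min (range a)"
proof -
  have ge: "0 \<le> Max (range b)" "0 \<le> Min (range b)" if "has_semi_axes E b" for b :: "'n \<Rightarrow> real"
  proof -
    have "\<And>i. 0 < b i" using that by (simp add: has_semi_axes_def)
    moreover have "Max (range b) \<in> range b" "Min (range b) \<in> range b"
      by (intro Max_in Min_in; simp)+
    ultimately show "0 \<le> Max (range b)" "0 \<le> Min (range b)"
      by (metis imageE less_imp_le)+
  qed
  have eq: "Max (range b) / Min (range b) = Max (range a) / Min (range a)"
    if b: "has_semi_axes E b" for b
  proof -
    note A = has_semi_axes_subset_cball_iff[OF assms] and B = has_semi_axes_subset_cball_iff[OF b]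
    have "Max (range b) = Max (range a)"
    proof (rule order.antisym)
      show "Max (range b) \<le> Max (range a)"
        using A[OF ge(1)[OF assms]] B[OF ge(1)[OF assms]] by blast
      show "Max (range a) \<le> Max (range b)"
        using A[OF ge(1)[OF b]] B[OF ge(1)[OF b]] by blast
    qed
    moreover
    note A = cball_subset_has_semi_axes_iff[OF assms] and B = cball_subset_has_semi_axes_iff[OF b]
    have "Min (range b) = Min (range a)"
    proof (rule order.antisym)
      show "Min (range b) \<le> Min (range a)"
        using A[OF ge(2)[OF b]] B[OF ge(2)[OF b]] by blast
      show "Min (range a) \<le> Min (range b)"
        using A[OF ge(2)[OF assms]] B[OF ge(2)[OF assms]] by blast
    qed
    ultimately show ?thesis by simp
  qed
  show ?thesis
    unfolding aspect_ratio_def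
  proof (rule the_equality)
    show "\<exists>b. has_semi_axes E b \<and> Max (range a) / Min (range a) = Max (range b) / Min (range b)"
      using assms by blast
    fix q assume "\<exists>b. has_semi_axes E b \<and> q = Max (range b) / Min (range b)"
    then show "q = Max (range a) / Min (range a)" using eq by blast
  qed
qed

end

(* If y / sqrt 2 lies outside X, separate it from X by a unit vector u and a number h: then X lies in
   the slab \<bar>u \<bullet> x\<bar> \<le> h and in the ball of its outer radius R, and u \<bullet> y > sqrt 2 * h.  The ellipsoid
   with semi-axis sqrt 2 * h along u and sqrt 2 * R orthogonally to u contains the intersection of the
   slab and the ball, and its aspect ratio R / h is at most kappa X because the inner radius of X is at
   most h.  It misses y, so y is not in the given ellipsoid. *)
theory Submission
  imports Defs
begin

lemma norm_power2_vec: "(norm x)\<^sup>2 = (\<Sum>i\<in>UNIV. (x $ i)\<^sup>2)" for x :: "real^'n"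
  by (simp add: norm_vec_def L2_set_def sum_nonneg)

text \<open>On the intersection, the slab and the ball each contribute at most 1/2 to the quadratic
  form of \<open>E\<close>. This is where the factor \<open>sqrt 2\<close> on all semi-axes comes
  from; it cancels in the aspect ratio.\<close>

lemma exists_ellipsoid_around_slab_Int_cball:
  fixes u :: "real^'n"
  assumes "norm u = 1" "0 < h" "h \<le> R"
  obtains E where "ellipsoid E" "aspect_ratio E \<le> R / h"
    "{x. \<bar>u \<bullet> x\<bar> \<le> h} \<inter> cball 0 R \<subseteq> E" "\<And>x. x \<in> E \<Longrightarrow> \<bar>u \<bullet> x\<bar> \<le> sqrt 2 * h"
proof -
  \<comment> \<open>Any coordinate will do: \<open>f\<close> is chosen to carry its axis to
    \<open>u\<close>.\<close>
  define k :: 'n where "k = undefined"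
  have "norm (axis k 1 :: real^'n) = norm u" by (simp add: norm_axis assms(1))
  then obtain f :: "real^'n \<Rightarrow> real^'n"
    where f: "orthogonal_transformation f" and fk: "f (axis k 1) = u"
    by (rule orthogonal_transformation_exists)
  define a where "a i = (if i = k then sqrt 2 * h else sqrt 2 * R)" for i
  define E where "E = f ` {x. (\<Sum>i\<in>UNIV. (x $ i / a i)\<^sup>2) \<le> 1}"
  have pos: "0 < a i" for i using assms by (simp add: a_def)
  have uf: "u \<bullet> f z = z $ k" for z
  proof -
    have "u \<bullet> f z = axis k 1 \<bullet> z"
      using f unfolding fk[symmetric] orthogonal_transformation_def by blast
    then show ?thesis by (simp add: inner_axis')
  qed
  have axes: "has_semi_axes E a"
    unfolding has_semi_axes_def E_def using f pos by blast
  \<comment> \<open>Bounds rather than equalities: in dimension one no semi-axis has length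
    \<open>sqrt 2 * R\<close>.\<close>
  have "Max (range a) \<le> sqrt 2 * R" "sqrt 2 * h \<le> Min (range a)"
    using assms by (auto simp: a_def)
  then have "Max (range a) / Min (range a) \<le> (sqrt 2 * R) / (sqrt 2 * h)"
    using assms by (intro frac_le) auto
  then have "aspect_ratio E \<le> R / h"
    using has_semi_axes_aspect_ratio[OF axes] by simp
  moreover have "{x. \<bar>u \<bullet> x\<bar> \<le> h} \<inter> cball 0 R \<subseteq> E"
  proof
    fix x assume x: "x \<in> {x. \<bar>u \<bullet> x\<bar> \<le> h} \<inter> cball 0 R"
    obtain z where z: "x = f z"
      using f by (meson orthogonal_transformation_surj surjD)
    have "norm z \<le> R"
      using x f by (simp add: z orthogonal_transformation_norm)
    then have "(norm z)\<^sup>2 \<le> R\<^sup>2" by (intro power_mono) auto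
    then have ball: "(norm z)\<^sup>2 / (2 * R\<^sup>2) \<le> 1 / 2" using assms by (simp add: field_simps)
    have "\<bar>z $ k\<bar>\<^sup>2 \<le> h\<^sup>2" using x by (intro power_mono) (auto simp: z uf)
    then have slab: "(z $ k)\<^sup>2 / (2 * h\<^sup>2) \<le> 1 / 2" using assms by (simp add: field_simps)
    \<comment> \<open>The term for \<open>k\<close> is enlarged by its share of the ball, so that
      the second summands add up to the full norm of \<open>z\<close>.\<close>
    have "(\<Sum>i\<in>UNIV. (z $ i / a i)\<^sup>2)
        \<le> (\<Sum>i\<in>UNIV. (if i = k then (z $ k)\<^sup>2 / (2 * h\<^sup>2) else 0) + (z $ i)\<^sup>2 / (2 * R\<^sup>2))"
      by (intro sum_mono) (simp add: a_def power_divide power_mult_distrib)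
    also have "\<dots> = (z $ k)\<^sup>2 / (2 * h\<^sup>2) + (norm z)\<^sup>2 / (2 * R\<^sup>2)"
      by (simp add: sum.distrib norm_power2_vec sum_divide_distrib)
    also have "\<dots> \<le> 1" using ball slab by simp
    finally show "x \<in> E" unfolding E_def z by simp
  qed
  moreover have "\<bar>u \<bullet> x\<bar> \<le> sqrt 2 * h" if xE: "x \<in> E" for x
  proof -
    obtain z where z: "x = f z" and "(\<Sum>i\<in>UNIV. (z $ i / a i)\<^sup>2) \<le> 1"
      using xE unfolding E_def by blast
    moreover have "(z $ k / a k)\<^sup>2 \<le> (\<Sum>i\<in>UNIV. (z $ i / a i)\<^sup>2)"
      by (rule member_le_sum) auto
    ultimately have "\<bar>z $ k / a k\<bar> \<le> 1" by (metis abs_square_le_1 order_trans)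
    then show ?thesis using pos[of k] by (simp add: z uf a_def abs_divide field_simps)
  qed
  moreover have "ellipsoid E" using axes unfolding ellipsoid_def by blast
  ultimately show ?thesis using that by blast
qed

text \<open>A ball in \<open>X\<close> around some \<open>c\<close> can be moved to the origin:
  \<open>v\<close> is the midpoint of \<open>c + v\<close> and the reflection of
  \<open>c - v\<close>.\<close>

lemma symmetric_convex_body_contains_cball:
  assumes "symmetric_convex_body X"
  obtains e where "0 < e" "cball 0 e \<subseteq> X"
proof -
  obtain c e where e: "0 < e" "cball c e \<subseteq> X"
    using assms unfolding symmetric_convex_body_def by (metis ex_in_conv mem_interior_cball)
  have "v \<in> X" if "norm v \<le> e" for v
  proof -
    have "c + v \<in> X" "c - v \<in> X"
      using e that by (auto simp: subset_iff dist_norm)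
    then have "c + v \<in> X" "- (c - v) \<in> X"
      using assms unfolding symmetric_convex_body_def by blast+
    then have "(1/2) *\<^sub>R (c + v) + (1/2) *\<^sub>R (- (c - v)) \<in> X"
      using assms unfolding symmetric_convex_body_def by (intro convexD) auto
    then show ?thesis by (simp add: algebra_simps flip: scaleR_add_left)
  qed
  with e show ?thesis by (intro that[of e]) auto
qed

text \<open>The norm of each point of \<open>X\<close> is a lower bound of the admissible radii.
  Boundedness makes their set nonempty, so that the infimum is meaningful.\<close>

lemma subset_cball_outer_radius:
  assumes "bounded X"
  shows "X \<subseteq> cball 0 (outer_radius X)"
proof
  fix x assume x: "x \<in> X"
  obtain B where B: "0 < B" "\<forall>x\<in>X. norm x \<le> B"
    using assms bounded_pos by blast
  then have "B \<in> {R. 0 \<le> R \<and> X \<subseteq> cball 0 R}" by auto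
  then have "norm x \<le> outer_radius X"
    unfolding outer_radius_def by (intro cInf_greatest) (use x in auto)
  then show "x \<in> cball 0 (outer_radius X)" by simp
qed

text \<open>If \<open>X\<close> contains the ball of radius \<open>r\<close>, then it contains
  \<open>r *\<^sub>R u\<close>, whence \<open>r \<le> h\<close>. This bound is also what makes the
  supremum meaningful, so positivity relies on it too.\<close>

lemma
  fixes X :: "(real^'n) set"
  assumes "norm u = 1" "\<And>x. x \<in> X \<Longrightarrow> u \<bullet> x \<le> h" "0 < e" "cball 0 e \<subseteq> X"
  shows inner_radius_pos: "0 < inner_radius X"
    and inner_radius_le_support: "inner_radius X \<le> h"
proof -
  have le: "r \<le> h" if "0 \<le> r" "cball 0 r \<subseteq> X" for r
  proof -
    have "r *\<^sub>R u \<in> X" using that assms(1) by auto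
    then show ?thesis using assms(2)[of "r *\<^sub>R u"] assms(1) by (simp add: dot_square_norm)
  qed
  have mem: "e \<in> {r. 0 \<le> r \<and> cball 0 r \<subseteq> X}" using assms by simp
  have "e \<le> inner_radius X"
    unfolding inner_radius_def
    using mem le by (intro cSup_upper bdd_aboveI[of _ h]) auto
  then show "0 < inner_radius X" using assms(3) by simp
  show "inner_radius X \<le> h"
    unfolding inner_radius_def using mem le by (intro cSup_least) auto
qed

lemma unit_separating_hyperplane:
  fixes X :: "'a::euclidean_space set"
  assumes "convex X" "closed X" "X \<noteq> {}" "z \<notin> X"
  obtains u b where "norm u = 1" "b < u \<bullet> z" "\<And>x. x \<in> X \<Longrightarrow> u \<bullet> x \<le> b"
proof -
  obtain a b where ab: "a \<bullet> z < b" "\<forall>x\<in>X. b < a \<bullet> x"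
    using separating_hyperplane_closed_point[OF assms(1,2,4)] by blast
  have "a \<noteq> 0" using ab assms(3) by force
  \<comment> \<open>The normal \<open>a\<close> points from \<open>z\<close> towards
    \<open>X\<close>, so its sign is flipped as it is normalised.\<close>
  then show ?thesis
    using ab by (intro that[of "- (a /\<^sub>R norm a)" "- (b / norm a)"])
      (auto simp: field_simps less_imp_le)
qed

theorem theorem8:
  fixes X \<E> :: "(real^'n) set"
  assumes "symmetric_convex_body X"
    and "ellipsoid \<E>"
    and "\<And>\<E>'. ellipsoid \<E>' \<Longrightarrow> X \<subseteq> \<E>' \<Longrightarrow> aspect_ratio \<E>' \<le> kappa X \<Longrightarrow> \<E> \<subseteq> \<E>'"
  shows "\<E> \<subseteq> (\<lambda>x. sqrt 2 *\<^sub>R x) ` X"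
proof
  fix y assume y: "y \<in> \<E>"
  define z where "z = y /\<^sub>R sqrt 2"
  have yz: "y = sqrt 2 *\<^sub>R z" by (simp add: z_def)
  have X: "convex X" "closed X" "bounded X" "\<And>x. x \<in> X \<Longrightarrow> - x \<in> X"
    using assms(1) by (auto simp: symmetric_convex_body_def compact_imp_closed compact_imp_bounded)
  obtain e where e: "0 < e" "cball 0 e \<subseteq> X"
    using symmetric_convex_body_contains_cball[OF assms(1)] by blast
  have "z \<in> X"
  proof (rule ccontr)
    assume "z \<notin> X"
    moreover have "X \<noteq> {}" using e by auto
    ultimately obtain u b where u: "norm u = 1" and b: "b < u \<bullet> z" "\<And>x. x \<in> X \<Longrightarrow> u \<bullet> x \<le> b"
      using unit_separating_hyperplane[OF X(1,2)] by metis
    define R where "R = outer_radius X"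
    \<comment> \<open>The separating value \<open>b\<close> may exceed \<open>R\<close>, but the
      ellipsoid needs \<open>h \<le> R\<close>. Both numbers bound \<open>u \<bullet> x\<close> on
      \<open>X\<close>, so the minimum does as well, and it still lies below
      \<open>u \<bullet> z\<close>.\<close>
    define h where "h = min b R"
    have XR: "X \<subseteq> cball 0 R" unfolding R_def by (rule subset_cball_outer_radius[OF X(3)])
    have uR: "u \<bullet> x \<le> R" if "x \<in> X" for x
      using norm_cauchy_schwarz[of u x] u XR that by auto
    have uh: "u \<bullet> x \<le> h" if "x \<in> X" for x
      using uR b(2) that by (simp add: h_def)
    note r = inner_radius_pos[OF u uh e] inner_radius_le_support[OF u uh e]
    have h: "0 < h" "h \<le> R" using r by (auto simp: h_def)
    obtain E where E: "ellipsoid E" "aspect_ratio E \<le> R / h"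
      "{x. \<bar>u \<bullet> x\<bar> \<le> h} \<inter> cball 0 R \<subseteq> E" "\<And>x. x \<in> E \<Longrightarrow> \<bar>u \<bullet> x\<bar> \<le> sqrt 2 * h"
      using exists_ellipsoid_around_slab_Int_cball[OF u h] by metis
    \<comment> \<open>Central symmetry turns the half-space containing \<open>X\<close> into a
      slab.\<close>
    have "\<bar>u \<bullet> x\<bar> \<le> h" if "x \<in> X" for x
      using uh[OF that] uh[OF X(4)[OF that]] by (simp add: abs_le_iff)
    then have "X \<subseteq> E" using XR E(3) by blast
    moreover have "R / h \<le> kappa X"
      unfolding kappa_def R_def[symmetric] using r h by (intro divide_left_mono) auto
    ultimately have "y \<in> E" using assms(3) E(1,2) y by (meson order_trans subsetD)
    then have "sqrt 2 * (u \<bullet> z) \<le> sqrt 2 * h"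
      using abs_le_D1[OF E(4)[of y]] by (simp add: yz)
    then show False using b(1) by (simp add: h_def)
  qed
  then show "y \<in> (\<lambda>x. sqrt 2 *\<^sub>R x) ` X" using yz by blast
qed

end
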